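(* For all positive integers $c$ and $n$, every $c$-closed graph on $n$ vertices has at most \[ \min\left\{3^{(c-1)/3}\, n^2,\ 4^{(c+4)(c-1)/2}\, n^{2-2^{1-c}}\right\} \] maximal cliques.
   Context: All graphs are finite, simple and undirected. For a positive integer $c$, a graph $G=(V,E)$ is $c$-closed if whenever two distinct vertices $u,v\in V$ have at least $c$ common neighbors, $u$ and $v$ are adjacent. A clique is a set of pairwise adjacent vertices; a maximal clique is a clique not contained in any strictly larger clique. *)

theory Defs
  imports Complex_Main "HOL-Library.Ramsey"
begin

(* Edges are two-element sets of vertices, so loops and multiple edges are excluded;
   this is the representation for which HOL-Library.Ramsey defines clique. *)
definition simple_graph :: "'a set \<Rightarrow> 'a set set \<Rightarrow> bool" where
  "simple_graph V E \<longleftrightarrow> finite V \<and> E \<subseteq> nsets V 2"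

definition common_neighbors :: "'a set \<Rightarrow> 'a set set \<Rightarrow> 'a \<Rightarrow> 'a \<Rightarrow> 'a set" where
  "common_neighbors V E u v = {w \<in> V. {u, w} \<in> E \<and> {v, w} \<in> E}"

definition c_closed :: "nat \<Rightarrow> 'a set \<Rightarrow> 'a set set \<Rightarrow> bool" where
  "c_closed c V E \<longleftrightarrow>
    (\<forall>u\<in>V. \<forall>v\<in>V. u \<noteq> v \<and> c \<le> card (common_neighbors V E u v) \<longrightarrow> {u, v} \<in> E)"

definition maximal_clique :: "'a set \<Rightarrow> 'a set set \<Rightarrow> 'a set \<Rightarrow> bool" where
  "maximal_clique V E K \<longleftrightarrow>
    K \<subseteq> V \<and> clique K E \<and> \<not> (\<exists>L. L \<subseteq> V \<and> clique L E \<and> K \<subset> L)"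

end

theory Submission
  imports Defs
begin

text \<open>
  The neighbourhood of a vertex in a (c+1)-closed graph is c-closed, and two distinct
  non-adjacent vertices have at most c common neighbours.

  First bound: delete a vertex v. The maximal cliques K for which K - {v} is still maximal in the
  rest of the graph inject into those of the rest. Any other K contains v and satisfies
  K - {v} \<open>\<subseteq>\<close> N(u) \<open>\<inter>\<close> N(v) for some u not adjacent to v; then K - {v} is maximal in this set,
  which is small, so the Moon--Moser bound applies.

  Second bound for (c+1)-closed graphs: by induction on c, where \<open>\<alpha>\<close> is the exponent for
  c-closed graphs. If the maximum degree d is
  at most \<open>\<surd>n\<close>, sum the bound for c over all neighbourhoods. Otherwise delete the closed
  neighbourhood of a vertex v of degree d. A maximal clique that contains v is counted in N(v). A
  maximal clique that meets N(v) without containing v splits into A \<open>\<subseteq>\<close> N(v) and a maximal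
  clique of the set D(A) of outside vertices joined to all of A. Every outside vertex lies in at
  most 2^c of the sets D(A), and each of these has at most d elements, so these
  cliques number at most a constant times n d^(\<open>\<alpha>\<close> - 1).
\<close>

section \<open>Maximal cliques and neighbourhoods in induced subgraphs\<close>

text \<open>Induced subgraphs are formed by shrinking \<open>W\<close> with \<open>E\<close> fixed.
  The auxiliary lemmas allow an arbitrary \<open>E\<close>, which may contain singletons, so
  \<open>w \<noteq> v\<close> is imposed explicitly.\<close>

definition neighbors :: "'a set \<Rightarrow> 'a set set \<Rightarrow> 'a \<Rightarrow> 'a set" where
  "neighbors W E v = {w \<in> W. w \<noteq> v \<and> {v, w} \<in> E}"

definition maximal_cliques :: "'a set \<Rightarrow> 'a set set \<Rightarrow> 'a set set" where
  "maximal_cliques W E = {K. maximal_clique W E K}"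

lemma neighbors_subset: "neighbors W E v \<subseteq> W"
  by (auto simp: neighbors_def)

lemma finite_neighbors: "finite W \<Longrightarrow> finite (neighbors W E v)"
  by (rule finite_subset[OF neighbors_subset])

lemma maximal_cliques_subset_Pow: "maximal_cliques W E \<subseteq> Pow W"
  by (auto simp: maximal_cliques_def maximal_clique_def)

lemma finite_maximal_cliques: "finite W \<Longrightarrow> finite (maximal_cliques W E)"
  by (rule finite_subset[OF maximal_cliques_subset_Pow]) simp

lemma maximal_cliques_clique: "clique W E \<Longrightarrow> maximal_cliques W E = {W}"
  by (auto simp: maximal_cliques_def maximal_clique_def)

lemma maximal_cliques_empty: "maximal_cliques {} E = {{}}"
  by (rule maximal_cliques_clique) (simp add: clique_def)

lemma empty_notin_maximal_cliques:
  assumes "W \<noteq> {}" shows "{} \<notin> maximal_cliques W E"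
proof -
  obtain v where "v \<in> W" using assms by blast
  hence "{v} \<subseteq> W" "clique {v} E" "{} \<subset> {v}" by (auto simp: clique_def)
  thus ?thesis unfolding maximal_cliques_def maximal_clique_def by blast
qed

text \<open>Since \<open>X\<close> is joined to all of \<open>D\<close>, a larger clique
  \<open>L\<close> in \<open>D\<close> would make \<open>X \<union> L\<close> a clique of
  \<open>W\<close> strictly containing \<open>K\<close>. All passages to smaller vertex sets rest on
  this, with \<open>X\<close> empty, a single vertex, or the trace of \<open>K\<close> on a
  neighbourhood.\<close>

lemma maximal_clique_Diff:
  assumes K: "maximal_clique W E K" and X: "X \<subseteq> K" and KD: "K - X \<subseteq> D"
    and DW: "D \<subseteq> W" and disj: "D \<inter> X = {}"
    and adj: "\<And>x d. x \<in> X \<Longrightarrow> d \<in> D \<Longrightarrow> {x, d} \<in> E"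
  shows "maximal_clique D E (K - X)"
  unfolding maximal_clique_def
proof (intro conjI notI)
  have cK: "clique K E" and KW: "K \<subseteq> W" using K by (auto simp: maximal_clique_def)
  show "K - X \<subseteq> D" by fact
  show "clique (K - X) E" using cK by (auto simp: clique_def)
  assume "\<exists>L. L \<subseteq> D \<and> clique L E \<and> K - X \<subset> L"
  then obtain L where L: "L \<subseteq> D" "clique L E" "K - X \<subset> L" by blast
  have "clique (X \<union> L) E"
    unfolding clique_def
  proof (intro ballI impI)
    fix x y assume "x \<in> X \<union> L" "y \<in> X \<union> L" "x \<noteq> y"
    moreover have "{a, b} \<in> E" if "a \<in> X" "b \<in> X" "a \<noteq> b" for a b
      using cK X that by (auto simp: clique_def)
    moreover have "{a, b} \<in> E" if "a \<in> L" "b \<in> L" "a \<noteq> b" for a b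
      using L(2) that by (auto simp: clique_def)
    moreover have "{a, b} \<in> E" "{b, a} \<in> E" if "a \<in> X" "b \<in> L" for a b
      using adj[of a b] L(1) that by (auto simp: insert_commute)
    ultimately show "{x, y} \<in> E" by blast
  qed
  moreover have "X \<union> L \<subseteq> W" using X KW L DW by auto
  moreover have "K \<subset> X \<union> L" using L disj by auto
  ultimately show False using K unfolding maximal_clique_def by blast
qed

lemma maximal_clique_subset:
  assumes "maximal_clique W E K" "K \<subseteq> D" "D \<subseteq> W"
  shows "maximal_clique D E K"
  using maximal_clique_Diff[of W E K "{}" D] assms by simp

lemma maximal_clique_neighbors:
  assumes "maximal_clique W E K" "v \<in> K"
  shows "K - {v} \<subseteq> neighbors W E v"
  using assms by (auto simp: neighbors_def maximal_clique_def clique_def)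

lemma maximal_clique_not_subset_neighbors:
  assumes K: "maximal_clique W E K" and v: "v \<in> W"
  shows "\<not> K \<subseteq> neighbors W E v"
proof
  assume sub: "K \<subseteq> neighbors W E v"
  have "clique (insert v K) E"
    using K sub by (auto simp: clique_def neighbors_def maximal_clique_def insert_commute)
  moreover have "insert v K \<subseteq> W" "K \<subset> insert v K"
    using K v sub by (auto simp: maximal_clique_def neighbors_def)
  ultimately show False using K unfolding maximal_clique_def by blast
qed

text \<open>Removing \<open>v\<close> is injective on sets that contain \<open>v\<close>, and what
  remains is maximal in the neighbourhood of \<open>v\<close>.\<close>

lemma card_maximal_cliques_containing:
  assumes "finite W"
  shows "card {K \<in> maximal_cliques W E. v \<in> K} \<le> card (maximal_cliques (neighbors W E v) E)"
proof (rule card_inj_on_le)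
  show "inj_on (\<lambda>K. K - {v}) {K \<in> maximal_cliques W E. v \<in> K}"
    by (auto intro!: inj_onI)
  show "(\<lambda>K. K - {v}) ` {K \<in> maximal_cliques W E. v \<in> K}
      \<subseteq> maximal_cliques (neighbors W E v) E"
  proof (clarsimp simp: maximal_cliques_def)
    fix K assume K: "maximal_clique W E K" "v \<in> K"
    show "maximal_clique (neighbors W E v) E (K - {v})"
      by (rule maximal_clique_Diff[OF K(1)])
        (use K maximal_clique_neighbors[OF K] in \<open>auto simp: neighbors_def\<close>)
  qed
  show "finite (maximal_cliques (neighbors W E v) E)"
    by (intro finite_maximal_cliques finite_neighbors assms)
qed

lemma card_maximal_cliques_le_sum:
  assumes fin: "finite W" and U: "U \<subseteq> W"
    and meet: "\<And>K. K \<in> maximal_cliques W E \<Longrightarrow> K \<inter> U \<noteq> {}"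
  shows "card (maximal_cliques W E) \<le> (\<Sum>u\<in>U. card (maximal_cliques (neighbors W E u) E))"
proof -
  have finU: "finite U" using fin U by (rule rev_finite_subset)
  have "card (maximal_cliques W E) \<le> card (\<Union>u\<in>U. {K \<in> maximal_cliques W E. u \<in> K})"
    using meet by (intro card_mono) (auto simp: finU finite_maximal_cliques fin)
  also have "\<dots> \<le> (\<Sum>u\<in>U. card {K \<in> maximal_cliques W E. u \<in> K})"
    by (rule card_UN_le[OF finU])
  also have "\<dots> \<le> (\<Sum>u\<in>U. card (maximal_cliques (neighbors W E u) E))"
    by (intro sum_mono card_maximal_cliques_containing fin)
  finally show ?thesis .
qed

lemma card_maximal_cliques_le_sum_neighbors:
  assumes fin: "finite W" and ne: "W \<noteq> {}"
  shows "card (maximal_cliques W E) \<le> (\<Sum>w\<in>W. card (maximal_cliques (neighbors W E w) E))"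
proof (rule card_maximal_cliques_le_sum[OF fin order_refl])
  fix K assume "K \<in> maximal_cliques W E"
  thus "K \<inter> W \<noteq> {}"
    using empty_notin_maximal_cliques[OF ne, of E] maximal_cliques_subset_Pow[of W E]
    by (metis Int_absorb2 PowD subsetD)
qed

lemma max_degree_vertex:
  assumes "finite W" "W \<noteq> {}"
  obtains v where "v \<in> W" "\<And>w. w \<in> W \<Longrightarrow> card (neighbors W E w) \<le> card (neighbors W E v)"
proof -
  let ?d = "\<lambda>w. card (neighbors W E w)"
  have "Max (?d ` W) \<in> ?d ` W" using assms by (intro Max_in) auto
  then obtain v where v: "v \<in> W" "?d v = Max (?d ` W)" by auto
  show ?thesis using v assms(1) by (intro that[of v]) auto
qed

subsection \<open>The Moon--Moser bound\<close>

lemma cube_le_three_power: "k ^ 3 \<le> (3::nat) ^ k"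
proof (cases "k < 3")
  case True
  hence "k = 0 \<or> k = 1 \<or> k = 2" by auto
  thus ?thesis by auto
next
  case False
  hence "3 \<le> k" by simp
  thus ?thesis
  proof (induction k rule: dec_induct)
    case (step k)
    have "3 * k\<^sup>2 \<le> k ^ 3" "3 * k \<le> k\<^sup>2"
      using step(1) by (auto simp: power2_eq_square power3_eq_cube)
    moreover have "Suc k ^ 3 = k ^ 3 + 3 * k\<^sup>2 + 3 * k + 1"
      by (simp add: power2_eq_square power3_eq_cube algebra_simps)
    ultimately have "Suc k ^ 3 \<le> 3 * k ^ 3" using step(1) by linarith
    with step(3) show ?case by simp
  qed simp
qed

text \<open>The cube root of \<open>cube_le_three_power\<close>, with equality at
  \<open>k = 3\<close>. It absorbs the number of branches in the Moon--Moser induction.\<close>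

lemma le_three_powr_third: "real k \<le> 3 powr (real k / 3)"
proof -
  have "real k ^ 3 \<le> 3 ^ k"
    using cube_le_three_power[of k] by (metis of_nat_le_iff of_nat_numeral of_nat_power)
  also have "\<dots> = (3 powr (real k / 3)) ^ 3"
    by (simp add: powr_power powr_realpow)
  finally show ?thesis by (subst (asm) power_mono_iff) auto
qed

text \<open>No maximal clique lies inside the neighbourhood of a vertex \<open>v\<close> of maximum
  degree, so branching over the set \<open>?U\<close> of non-neighbours, \<open>v\<close> included,
  catches all of them. Each branch is a neighbourhood with at most \<open>card W - card ?U\<close>
  vertices.\<close>

lemma moon_moser:
  assumes "finite W"
  shows "real (card (maximal_cliques W E)) \<le> 3 powr (real (card W) / 3)"
  using assms
proof (induction "card W" arbitrary: W rule: less_induct)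
  case less
  show ?case
  proof (cases "W = {}")
    case True thus ?thesis by (simp add: maximal_cliques_empty)
  next
    case False
    obtain v where v: "v \<in> W"
      and max: "\<And>w. w \<in> W \<Longrightarrow> card (neighbors W E w) \<le> card (neighbors W E v)"
      using max_degree_vertex[OF less.prems False] by blast
    let ?U = "W - neighbors W E v"
    have cardW: "card W = card ?U + card (neighbors W E v)"
      using card_Diff_subset[OF finite_neighbors[OF less.prems] neighbors_subset, of E v]
        card_mono[OF less.prems neighbors_subset, of E v] by simp
    have "card (maximal_cliques W E) \<le> (\<Sum>u\<in>?U. card (maximal_cliques (neighbors W E u) E))"
    proof (rule card_maximal_cliques_le_sum[OF less.prems])
      fix K assume "K \<in> maximal_cliques W E"
      hence K: "maximal_clique W E K" by (simp add: maximal_cliques_def)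
      hence "K \<subseteq> W" by (simp add: maximal_clique_def)
      thus "K \<inter> ?U \<noteq> {}" using maximal_clique_not_subset_neighbors[OF K v] by blast
    qed auto
    hence "real (card (maximal_cliques W E))
        \<le> (\<Sum>u\<in>?U. real (card (maximal_cliques (neighbors W E u) E)))"
      unfolding of_nat_sum[symmetric] of_nat_le_iff .
    also have "\<dots> \<le> (\<Sum>u\<in>?U. 3 powr (real (card (neighbors W E v)) / 3))"
    proof (rule sum_mono)
      fix u assume u: "u \<in> ?U"
      have "neighbors W E u \<subset> W" using u by (auto simp: neighbors_def)
      hence "real (card (maximal_cliques (neighbors W E u) E))
          \<le> 3 powr (real (card (neighbors W E u)) / 3)"
        by (intro less.hyps psubset_card_mono finite_neighbors less.prems)
      also have "\<dots> \<le> 3 powr (real (card (neighbors W E v)) / 3)"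
        using max[of u] u by (intro powr_mono) auto
      finally show "real (card (maximal_cliques (neighbors W E u) E)) \<le> \<dots>" .
    qed
    also have "\<dots> = real (card ?U) * 3 powr (real (card (neighbors W E v)) / 3)" by simp
    also have "\<dots> \<le> 3 powr (real (card ?U) / 3) * 3 powr (real (card (neighbors W E v)) / 3)"
      by (intro mult_right_mono le_three_powr_third) simp
    also have "\<dots> = 3 powr (real (card W) / 3)"
      by (simp add: cardW powr_add[symmetric] add_divide_distrib)
    finally show ?thesis .
  qed
qed

subsection \<open>Closed graphs\<close>

lemma c_closed_subset:
  assumes "c_closed c W E" "D \<subseteq> W" "finite W"
  shows "c_closed c D E"
  unfolding c_closed_def
proof (intro ballI impI)
  fix u v assume uv: "u \<in> D" "v \<in> D" "u \<noteq> v \<and> c \<le> card (common_neighbors D E u v)"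
  have "card (common_neighbors D E u v) \<le> card (common_neighbors W E u v)"
    using assms by (intro card_mono) (auto simp: common_neighbors_def)
  thus "{u, v} \<in> E" using assms uv unfolding c_closed_def by (meson le_trans subsetD)
qed

text \<open>Two vertices of the neighbourhood have \<open>v\<close> itself as one more common
  neighbour, outside the neighbourhood.\<close>

lemma c_closed_neighbors:
  assumes cl: "c_closed (Suc c) W E" and fin: "finite W" and v: "v \<in> W"
  shows "c_closed c (neighbors W E v) E"
  unfolding c_closed_def
proof (intro ballI impI)
  let ?N = "neighbors W E v"
  fix x y assume xy: "x \<in> ?N" "y \<in> ?N" "x \<noteq> y \<and> c \<le> card (common_neighbors ?N E x y)"
  have "card (insert v (common_neighbors ?N E x y)) \<le> card (common_neighbors W E x y)"
    using xy v fin by (intro card_mono) (auto simp: common_neighbors_def neighbors_def insert_commute)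
  moreover have "card (insert v (common_neighbors ?N E x y)) = Suc (card (common_neighbors ?N E x y))"
    using fin by (intro card_insert_disjoint) (auto simp: common_neighbors_def neighbors_def)
  ultimately have "Suc c \<le> card (common_neighbors W E x y)" using xy by linarith
  thus "{x, y} \<in> E" using cl xy neighbors_subset[of W E v] unfolding c_closed_def by blast
qed

lemma c_closed_card_neighbors_Int:
  assumes cl: "c_closed (Suc c) W E" and fin: "finite W" and uv: "u \<in> W" "v \<in> W" "u \<noteq> v"
    and nadj: "u \<notin> neighbors W E v"
  shows "card (neighbors W E u \<inter> neighbors W E v) \<le> c"
proof -
  have "{u, v} \<notin> E" using nadj uv by (auto simp: neighbors_def insert_commute)
  hence "card (common_neighbors W E u v) \<le> c"
    using cl uv unfolding c_closed_def by (metis not_less_eq_eq)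
  moreover have "card (neighbors W E u \<inter> neighbors W E v) \<le> card (common_neighbors W E u v)"
    using fin by (intro card_mono) (auto simp: common_neighbors_def neighbors_def)
  ultimately show ?thesis by linarith
qed

lemma c_closed_0_clique: "c_closed 0 W E \<Longrightarrow> clique W E"
  by (auto simp: c_closed_def clique_def)

subsection \<open>The quadratic bound\<close>

text \<open>The factor \<open>card W - 1\<close> bounds the choices of \<open>u\<close>, and
  \<open>3 powr (real c / 3)\<close> is the Moon--Moser bound on at most \<open>c\<close> common
  neighbours of \<open>u\<close> and \<open>v\<close>.\<close>

lemma card_maximal_cliques_delete_vertex:
  assumes fin: "finite W" and v: "v \<in> W" and cl: "c_closed (Suc c) W E"
  shows "real (card (maximal_cliques W E)) \<le> real (card (maximal_cliques (W - {v}) E))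
      + real (card W - 1) * 3 powr (real c / 3)"
proof -
  let ?S = "{K \<in> maximal_cliques W E. K - {v} \<in> maximal_cliques (W - {v}) E}"
  let ?U = "W - {v} - neighbors W E v"
  let ?D = "\<lambda>u. neighbors W E u \<inter> neighbors W E v"
  have finS: "finite ?S" by (simp add: finite_maximal_cliques fin)
  have finD: "finite (?D u)" for u by (simp add: finite_neighbors fin)
  \<comment> \<open>Two sets that agree off \<open>v\<close> are nested, so two such maximal cliques
    coincide.\<close>
  have "inj_on (\<lambda>K. K - {v}) ?S"
  proof (rule inj_onI)
    fix K L assume KL: "K \<in> ?S" "L \<in> ?S" "K - {v} = L - {v}"
    have "maximal_clique W E K" "maximal_clique W E L"
      using KL by (auto simp: maximal_cliques_def)
    hence "\<not> K \<subset> L" "\<not> L \<subset> K" by (auto simp only: maximal_clique_def)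
    thus "K = L" using KL(3) by blast
  qed
  hence S: "card ?S \<le> card (maximal_cliques (W - {v}) E)"
    by (rule card_inj_on_le) (auto simp: finite_maximal_cliques fin)
  have sub: "maximal_cliques W E \<subseteq> ?S \<union> (\<Union>u\<in>?U. insert v ` maximal_cliques (?D u) E)"
  proof
    fix K assume K': "K \<in> maximal_cliques W E"
    hence K: "maximal_clique W E K" by (simp add: maximal_cliques_def)
    have KW: "K \<subseteq> W" and cK: "clique K E" using K by (auto simp: maximal_clique_def)
    show "K \<in> ?S \<union> (\<Union>u\<in>?U. insert v ` maximal_cliques (?D u) E)"
    proof (cases "K \<in> ?S")
      case False
      hence nm: "\<not> maximal_clique (W - {v}) E (K - {v})" using K' by (simp add: maximal_cliques_def)
      have vK: "v \<in> K"
      proof (rule ccontr)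
        assume "v \<notin> K"
        hence "K - {v} = K" "K \<subseteq> W - {v}" using KW by auto
        thus False using nm maximal_clique_subset[OF K, of "W - {v}"] by auto
      qed
      have "clique (K - {v}) E" using cK by (auto simp: clique_def)
      then obtain L where L: "L \<subseteq> W - {v}" "clique L E" "K - {v} \<subset> L"
        using nm KW unfolding maximal_clique_def by blast
      \<comment> \<open>This \<open>u\<close> is adjacent to all of \<open>K - {v}\<close>. Were it
        also adjacent to \<open>v\<close>, it would extend \<open>K\<close>, so it is a
        non-neighbour of \<open>v\<close>.\<close>
      then obtain u where u: "u \<in> L" "u \<notin> K" by blast
      have KD1: "K - {v} \<subseteq> neighbors W E u"
      proof
        fix x assume x: "x \<in> K - {v}"
        hence "x \<in> L" "x \<noteq> u" using L(3) u by auto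
        hence "{u, x} \<in> E" using L(2) u(1) by (simp add: clique_def)
        thus "x \<in> neighbors W E u" using x KW \<open>x \<noteq> u\<close> by (auto simp: neighbors_def)
      qed
      have KD2: "K - {v} \<subseteq> neighbors W E v" by (rule maximal_clique_neighbors[OF K vK])
      have "u \<notin> neighbors W E v"
      proof
        assume "u \<in> neighbors W E v"
        hence "K \<subseteq> neighbors W E u"
          using KD1 vK KW by (auto simp: neighbors_def insert_commute)
        thus False using maximal_clique_not_subset_neighbors[OF K] u L by blast
      qed
      hence uU: "u \<in> ?U" using u L by auto
      have "maximal_clique (?D u) E (K - {v})"
        by (rule maximal_clique_Diff[OF K])
          (use vK KD1 KD2 in \<open>auto simp: neighbors_def\<close>)
      hence "K - {v} \<in> maximal_cliques (?D u) E" by (simp add: maximal_cliques_def)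
      moreover have "K = insert v (K - {v})" using vK by auto
      ultimately have "K \<in> insert v ` maximal_cliques (?D u) E" by (rule image_eqI[rotated])
      thus ?thesis using uU by (intro UnI2 UN_I)
    qed simp
  qed
  have "card (maximal_cliques W E) \<le> card (?S \<union> (\<Union>u\<in>?U. insert v ` maximal_cliques (?D u) E))"
    using sub by (rule card_mono[rotated]) (simp add: finS fin finite_maximal_cliques finD)
  also have "\<dots> \<le> card ?S + card (\<Union>u\<in>?U. insert v ` maximal_cliques (?D u) E)"
    by (rule card_Un_le)
  also have "\<dots> \<le> card ?S + (\<Sum>u\<in>?U. card (insert v ` maximal_cliques (?D u) E))"
    by (intro add_left_mono card_UN_le) (simp add: fin)
  also have "\<dots> \<le> card (maximal_cliques (W - {v}) E) + (\<Sum>u\<in>?U. card (maximal_cliques (?D u) E))"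
    by (intro add_mono S sum_mono card_image_le finite_maximal_cliques finD)
  finally have "real (card (maximal_cliques W E)) \<le> real (card (maximal_cliques (W - {v}) E))
      + (\<Sum>u\<in>?U. real (card (maximal_cliques (?D u) E)))"
    unfolding of_nat_add[symmetric] of_nat_sum[symmetric] of_nat_le_iff .
  also have "(\<Sum>u\<in>?U. real (card (maximal_cliques (?D u) E))) \<le> (\<Sum>u\<in>?U. 3 powr (real c / 3))"
  proof (rule sum_mono)
    fix u assume u: "u \<in> ?U"
    have "real (card (maximal_cliques (?D u) E)) \<le> 3 powr (real (card (?D u)) / 3)"
      by (rule moon_moser[OF finD])
    also have "\<dots> \<le> 3 powr (real c / 3)"
      using c_closed_card_neighbors_Int[OF cl fin, of u v] u v by (intro powr_mono) auto
    finally show "real (card (maximal_cliques (?D u) E)) \<le> \<dots>" .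
  qed
  also have "\<dots> = real (card ?U) * 3 powr (real c / 3)" by simp
  also have "\<dots> \<le> real (card W - 1) * 3 powr (real c / 3)"
  proof -
    have "card ?U \<le> card (W - {v})" using fin by (intro card_mono) auto
    thus ?thesis using v fin by (intro mult_right_mono) auto
  qed
  finally show ?thesis by simp
qed

text \<open>Vertices are added one at a time, using \<open>?n ^ 2 + ?n \<le> (?n + 1) ^ 2\<close>.
  The induction starts at a singleton because the empty graph has one maximal clique, the empty one,
  while the bound there is 0.\<close>

lemma card_maximal_cliques_quadratic:
  assumes "finite W" "W \<noteq> {}" "c_closed (Suc c) W E"
  shows "real (card (maximal_cliques W E)) \<le> 3 powr (real c / 3) * real (card W) ^ 2"
  using assms
proof (induction W rule: finite_ne_induct)
  case (singleton x)
  have "maximal_cliques {x} E = {{x}}" by (rule maximal_cliques_clique) (simp add: clique_def)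
  thus ?case by (simp add: ge_one_powr_ge_zero)
next
  case (insert v W)
  let ?T = "3 powr (real c / 3)" and ?n = "real (card W)"
  have "c_closed (Suc c) W E"
    using c_closed_subset[OF insert.prems, of W] insert by auto
  hence IH: "real (card (maximal_cliques W E)) \<le> ?T * ?n ^ 2" by (rule insert.IH)
  have "real (card (maximal_cliques (insert v W) E))
      \<le> real (card (maximal_cliques W E)) + ?n * ?T"
    using card_maximal_cliques_delete_vertex[OF _ _ insert.prems, of v] insert by simp
  also have "\<dots> \<le> ?T * (?n ^ 2 + ?n)" using IH by (simp add: algebra_simps)
  also have "\<dots> \<le> ?T * (?n + 1) ^ 2"
    by (intro mult_left_mono) (auto simp: power2_eq_square algebra_simps)
  also have "?n + 1 = real (card (insert v W))" using insert by simp
  finally show ?case .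
qed

subsection \<open>The subquadratic bound\<close>

text \<open>Double counting of pairs \<open>(A, u)\<close>: for fixed \<open>u\<close> the
  admissible \<open>A\<close> are exactly the subsets of the set of neighbours of \<open>u\<close>
  in \<open>N\<close>.\<close>

lemma sum_card_joined_le:
  assumes "finite R" "finite N" and "\<And>u. u \<in> R \<Longrightarrow> card {a \<in> N. {a, u} \<in> E} \<le> c"
  shows "(\<Sum>A\<in>Pow N. card {u \<in> R. \<forall>a\<in>A. {a, u} \<in> E}) \<le> card R * 2 ^ c"
proof -
  have "(\<Sum>A\<in>Pow N. card {u \<in> R. \<forall>a\<in>A. {a, u} \<in> E})
      = (\<Sum>u\<in>R. card {A \<in> Pow N. \<forall>a\<in>A. {a, u} \<in> E})"
    using assms by (intro sum_multicount_gen) auto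
  also have "\<dots> \<le> (\<Sum>u\<in>R. 2 ^ c)"
  proof (rule sum_mono)
    fix u assume u: "u \<in> R"
    have "{A \<in> Pow N. \<forall>a\<in>A. {a, u} \<in> E} = Pow {a \<in> N. {a, u} \<in> E}" by auto
    thus "card {A \<in> Pow N. \<forall>a\<in>A. {a, u} \<in> E} \<le> 2 ^ c"
      using assms u by (simp add: card_Pow power_increasing)
  qed
  finally show ?thesis by simp
qed

text \<open>The terms count the maximal cliques that avoid \<open>insert v N\<close>, those that
  contain \<open>v\<close>, and those that meet \<open>N\<close> in a nonempty trace
  \<open>A\<close> without containing \<open>v\<close>. For empty \<open>R\<close> the first class
  is empty, although \<open>maximal_cliques {} E\<close> has one element; hence the case
  distinction.\<close>

lemma card_maximal_cliques_delete_neighborhood: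
  fixes E :: "'a set set"
  assumes fin: "finite W" and v: "v \<in> W"
  defines "N \<equiv> neighbors W E v"
  defines "R \<equiv> W - insert v N"
  defines "D \<equiv> \<lambda>A. {u \<in> R. \<forall>a\<in>A. {a, u} \<in> E}"
  shows "card (maximal_cliques W E) \<le> (if R = {} then 0 else card (maximal_cliques R E))
      + card (maximal_cliques N E)
      + (\<Sum>A | A \<subseteq> N \<and> A \<noteq> {} \<and> D A \<noteq> {}. card (maximal_cliques (D A) E))"
proof -
  let ?S1 = "if R = {} then {} else maximal_cliques R E"
  let ?S2 = "{K \<in> maximal_cliques W E. v \<in> K}"
  let ?A = "{A. A \<subseteq> N \<and> A \<noteq> {} \<and> D A \<noteq> {}}"
  let ?S3 = "\<Union>A\<in>?A. (\<union>) A ` maximal_cliques (D A) E"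
  have finN: "finite N" unfolding N_def by (rule finite_neighbors[OF fin])
  have finR: "finite R" using fin by (simp add: R_def)
  have finD: "finite (D A)" for A using finR by (simp add: D_def)
  have finA: "finite ?A" by (rule finite_subset[of _ "Pow N"]) (use finN in auto)
  have sub: "maximal_cliques W E \<subseteq> ?S1 \<union> ?S2 \<union> ?S3"
  proof
    fix K assume K': "K \<in> maximal_cliques W E"
    hence K: "maximal_clique W E K" by (simp add: maximal_cliques_def)
    have KW: "K \<subseteq> W" and cK: "clique K E" using K by (auto simp: maximal_clique_def)
    consider "v \<in> K" | "v \<notin> K" "K \<inter> N = {}" | "v \<notin> K" "K \<inter> N \<noteq> {}" by blast
    thus "K \<in> ?S1 \<union> ?S2 \<union> ?S3"
    proof cases
      case 1
      hence "K \<in> ?S2" using K' by simp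
      thus ?thesis by (intro UnI1 UnI2)
    next
      case 2
      hence "K \<subseteq> R" using KW by (auto simp: R_def)
      moreover have "K \<noteq> {}" using K' empty_notin_maximal_cliques[of W E] v by (metis empty_iff)
      moreover have "maximal_clique R E K"
        by (rule maximal_clique_subset[OF K \<open>K \<subseteq> R\<close>]) (auto simp: R_def)
      ultimately have "K \<in> ?S1" by (auto simp: maximal_cliques_def)
      thus ?thesis by (intro UnI1)
    next
      case 3
      \<comment> \<open>This makes \<open>D (K \<inter> N)\<close> nonempty, so the trace belongs to
        the index set \<open>?A\<close>.\<close>
      have KN: "\<not> K \<subseteq> N" unfolding N_def by (rule maximal_clique_not_subset_neighbors[OF K v])
      have NR: "N \<inter> R = {}" and RW: "R \<subseteq> W" by (auto simp: R_def)
      have KR: "K - N \<subseteq> R" using 3 KW by (auto simp: R_def)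
      have KD: "K - (K \<inter> N) \<subseteq> D (K \<inter> N)"
      proof
        fix u assume u: "u \<in> K - (K \<inter> N)"
        have "{a, u} \<in> E" if "a \<in> K \<inter> N" for a
        proof -
          have "a \<noteq> u" using that u by auto
          thus ?thesis using cK that u by (simp add: clique_def)
        qed
        moreover have "u \<in> R" using KR u by blast
        ultimately show "u \<in> D (K \<inter> N)" by (simp add: D_def)
      qed
      have "maximal_clique (D (K \<inter> N)) E (K - (K \<inter> N))"
      proof (rule maximal_clique_Diff[OF K _ KD])
        show "D (K \<inter> N) \<subseteq> W" "D (K \<inter> N) \<inter> (K \<inter> N) = {}" using NR RW by (auto simp: D_def)
      qed (auto simp: D_def)
      hence "K - (K \<inter> N) \<in> maximal_cliques (D (K \<inter> N)) E" by (simp add: maximal_cliques_def)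
      moreover have "K = (K \<inter> N) \<union> (K - (K \<inter> N))" by auto
      ultimately have "K \<in> (\<union>) (K \<inter> N) ` maximal_cliques (D (K \<inter> N)) E"
        by (rule image_eqI[rotated])
      moreover have "K \<inter> N \<in> ?A" using 3 KD KN by auto
      ultimately show ?thesis by (intro UnI2 UN_I)
    qed
  qed
  have "card (maximal_cliques W E) \<le> card (?S1 \<union> ?S2 \<union> ?S3)"
    using sub by (rule card_mono[rotated])
      (simp add: finA fin finite_maximal_cliques finR finD)
  also have "\<dots> \<le> card ?S1 + card ?S2 + card ?S3"
    using card_Un_le[of "?S1 \<union> ?S2" ?S3] card_Un_le[of ?S1 ?S2] by linarith
  also have "\<dots> \<le> card ?S1 + card ?S2 + (\<Sum>A\<in>?A. card ((\<union>) A ` maximal_cliques (D A) E))"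
    by (intro add_left_mono card_UN_le finA)
  also have "\<dots> \<le> card ?S1 + card (maximal_cliques N E) + (\<Sum>A\<in>?A. card (maximal_cliques (D A) E))"
    unfolding N_def
    by (intro add_mono order_refl sum_mono card_image_le finite_maximal_cliques finD
        card_maximal_cliques_containing fin)
  also have "card ?S1 = (if R = {} then 0 else card (maximal_cliques R E))" by simp
  finally show ?thesis .
qed

text \<open>Replacing \<open>n\<close> by \<open>r \<le> n - d\<close> saves
  \<open>(1 + k) * d * n powr (\<alpha> / 2)\<close> in the first term. The second term costs at
  most one share \<open>d * n powr (\<alpha> / 2)\<close> of this and the third at most
  \<open>k\<close> shares.\<close>

lemma deletion_step_inequality:
  fixes n d r k \<alpha> :: real
  assumes \<alpha>: "1 \<le> \<alpha>" "\<alpha> \<le> 2" and n: "1 \<le> n" and d: "sqrt n \<le> d" "d \<le> n"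
    and r: "0 \<le> r" "r \<le> n - d" and k: "0 \<le> k"
  shows "(1 + k) * r powr (1 + \<alpha> / 2) + d powr \<alpha> + k * n * d powr (\<alpha> - 1)
    \<le> (1 + k) * n powr (1 + \<alpha> / 2)"
proof -
  have sn: "1 \<le> sqrt n" using n by simp
  have d0: "0 < d" using d sn by linarith
  have nh: "n powr (1 + \<alpha> / 2) = n * n powr (\<alpha> / 2)" using n by (simp add: powr_add)
  have "r powr (1 + \<alpha> / 2) \<le> (n - d) * n powr (\<alpha> / 2)"
  proof (cases "r = 0")
    case True thus ?thesis using d n by simp
  next
    case False
    hence "r powr (1 + \<alpha> / 2) = r * r powr (\<alpha> / 2)" using r by (simp add: powr_add)
    also have "\<dots> \<le> (n - d) * n powr (\<alpha> / 2)"
      using r d d0 \<alpha> by (intro mult_mono powr_mono2) auto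
    finally show ?thesis .
  qed
  hence 1: "(1 + k) * r powr (1 + \<alpha> / 2) \<le> (1 + k) * ((n - d) * n powr (\<alpha> / 2))"
    using k by (intro mult_left_mono) auto
  have "d powr \<alpha> = d * d powr (\<alpha> - 1)" using d0 by (simp add: powr_diff)
  also have "\<dots> \<le> d * n powr (\<alpha> - 1)"
    using d d0 \<alpha> by (intro mult_left_mono powr_mono2) auto
  \<comment> \<open>Here \<open>\<alpha> \<le> 2\<close> enters as
    \<open>\<alpha> - 1 \<le> \<alpha> / 2\<close>.\<close>
  also have "\<dots> \<le> d * n powr (\<alpha> / 2)"
    using d0 n \<alpha> by (intro mult_left_mono powr_mono) auto
  finally have 2: "d powr \<alpha> \<le> d * n powr (\<alpha> / 2)" .
  \<comment> \<open>The third term needs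
    \<open>n powr (1 - \<alpha> / 2) \<le> d powr (2 - \<alpha>)\<close>, which is where
    \<open>sqrt n \<le> d\<close> is used.\<close>
  have "n powr (1 - \<alpha> / 2) = sqrt n powr (2 - \<alpha>)"
    using n by (simp add: powr_half_sqrt[symmetric] powr_powr diff_divide_distrib)
  also have "\<dots> \<le> d powr (2 - \<alpha>)" using d n \<alpha> by (intro powr_mono2) auto
  finally have le: "n powr (1 - \<alpha> / 2) \<le> d powr (2 - \<alpha>)" .
  have "n * d powr (\<alpha> - 1) = n powr (\<alpha> / 2) * n powr (1 - \<alpha> / 2) * d powr (\<alpha> - 1)"
    using n by (simp add: powr_add[symmetric])
  also have "\<dots> \<le> n powr (\<alpha> / 2) * d powr (2 - \<alpha>) * d powr (\<alpha> - 1)"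
    using le by (intro mult_left_mono mult_right_mono) auto
  also have "\<dots> = d * n powr (\<alpha> / 2)"
    using d0 by (simp add: powr_add[symmetric] mult.assoc)
  finally have "k * (n * d powr (\<alpha> - 1)) \<le> k * (d * n powr (\<alpha> / 2))"
    using k by (rule mult_left_mono)
  with 1 2 show ?thesis unfolding nh by (simp add: algebra_simps)
qed

text \<open>At degree \<open>sqrt n\<close> the sum over \<open>n\<close> neighbourhoods gives
  exactly the exponent \<open>1 + \<alpha> / 2\<close>. Above it, induction on \<open>card W\<close>
  applies to \<open>R\<close>, and \<open>deletion_step_inequality\<close> with
  \<open>k = 2 ^ c\<close> closes the recursion.\<close>

lemma card_maximal_cliques_step:
  fixes B \<alpha> :: real
  assumes \<alpha>: "1 \<le> \<alpha>" "\<alpha> \<le> 2" and B: "1 \<le> B"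
    and bound: "\<And>D. finite D \<Longrightarrow> D \<noteq> {} \<Longrightarrow> c_closed c D E \<Longrightarrow>
      real (card (maximal_cliques D E)) \<le> B * real (card D) powr \<alpha>"
    and W: "finite W" "W \<noteq> {}" "c_closed (Suc c) W E"
  shows "real (card (maximal_cliques W E))
    \<le> B * (1 + 2 ^ c) * real (card W) powr (1 + \<alpha> / 2)"
  using W
proof (induction "card W" arbitrary: W rule: less_induct)
  case less
  note fin = \<open>finite W\<close> and cl = \<open>c_closed (Suc c) W E\<close>
  obtain v where v: "v \<in> W"
    and max: "\<And>w. w \<in> W \<Longrightarrow> card (neighbors W E w) \<le> card (neighbors W E v)"
    using max_degree_vertex[OF less.prems(1,2)] by blast
  define N where "N = neighbors W E v"
  define n where "n = real (card W)"
  define d where "d = real (card N)"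
  have finN: "finite N" unfolding N_def by (rule finite_neighbors[OF fin])
  have n1: "1 \<le> n" using less.prems by (simp add: n_def Suc_le_eq card_gt_0_iff)
  have ncl: "c_closed c (neighbors W E w) E" if "w \<in> W" for w
    by (rule c_closed_neighbors[OF cl fin that])
  show ?case
  proof (cases "d \<le> sqrt n")
    case True
    have nb: "real (card (maximal_cliques (neighbors W E w) E)) \<le> B * n powr (\<alpha> / 2)"
      if w: "w \<in> W" for w
    proof (cases "neighbors W E w = {}")
      case True
      \<comment> \<open>\<open>bound\<close> excludes the empty set, whose single maximal clique is
        covered by \<open>1 \<le> B\<close> and \<open>1 \<le> n\<close>.\<close>
      have "1 * 1 \<le> B * n powr (\<alpha> / 2)"
        using B n1 \<alpha> by (intro mult_mono ge_one_powr_ge_zero) auto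
      thus ?thesis by (simp add: True maximal_cliques_empty)
    next
      case False
      have "real (card (maximal_cliques (neighbors W E w) E))
          \<le> B * real (card (neighbors W E w)) powr \<alpha>"
        by (rule bound[OF finite_neighbors[OF fin] False ncl[OF w]])
      also have "\<dots> \<le> B * sqrt n powr \<alpha>"
        using max[OF w] \<open>d \<le> sqrt n\<close> B \<alpha>
        by (intro mult_left_mono powr_mono2) (auto simp: d_def N_def)
      also have "sqrt n powr \<alpha> = n powr (\<alpha> / 2)"
        using n1 by (simp add: powr_half_sqrt[symmetric] powr_powr)
      finally show ?thesis .
    qed
    have "card (maximal_cliques W E) \<le> (\<Sum>w\<in>W. card (maximal_cliques (neighbors W E w) E))"
      by (rule card_maximal_cliques_le_sum_neighbors[OF fin less.prems(2)])
    hence "real (card (maximal_cliques W E))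
        \<le> (\<Sum>w\<in>W. real (card (maximal_cliques (neighbors W E w) E)))"
      unfolding of_nat_sum[symmetric] of_nat_le_iff .
    also have "\<dots> \<le> (\<Sum>w\<in>W. B * n powr (\<alpha> / 2))" by (intro sum_mono nb)
    also have "\<dots> = B * 1 * n powr (1 + \<alpha> / 2)"
      using n1 by (simp add: n_def[symmetric] powr_add)
    also have "\<dots> \<le> B * (1 + 2 ^ c) * n powr (1 + \<alpha> / 2)"
      using B by (intro mult_right_mono mult_left_mono) auto
    finally show ?thesis unfolding n_def .
  next
    case False
    hence dn: "sqrt n \<le> d" by simp
    have d1: "1 \<le> d" using dn n1 real_sqrt_ge_one[OF n1] by linarith
    define R where "R = W - insert v N"
    define D where "D = (\<lambda>A. {u \<in> R. \<forall>a\<in>A. {a, u} \<in> E})"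
    define r where "r = real (card R)"
    define \<A> where "\<A> = {A. A \<subseteq> N \<and> A \<noteq> {} \<and> D A \<noteq> {}}"
    have RW: "R \<subseteq> W" "finite R" using fin by (auto simp: R_def)
    have finD: "finite (D A)" for A using RW by (simp add: D_def)
    have NW: "insert v N \<subseteq> W" "v \<notin> N" using v by (auto simp: N_def neighbors_def)
    have "card R + card (insert v N) = card W"
      unfolding R_def using NW fin finN
      by (metis add.commute card_Diff_subset card_mono finite_insert le_add_diff_inverse)
    hence rd: "r + d + 1 = n" using NW finN by (simp add: r_def d_def n_def)
    have r0: "0 \<le> r" by (simp add: r_def)
    have bR: "real (if R = {} then 0 else card (maximal_cliques R E))
        \<le> B * (1 + 2 ^ c) * r powr (1 + \<alpha> / 2)"
    proof (cases "R = {}")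
      case False
      have "R \<subset> W" using v by (auto simp: R_def)
      hence "card R < card W" by (rule psubset_card_mono[OF fin])
      thus ?thesis
        using less.hyps[OF _ RW(2) False c_closed_subset[OF cl RW(1) fin]] False
        by (simp add: r_def)
    qed (simp add: r_def)
    have "N \<noteq> {}" using d1 by (auto simp: d_def)
    hence bN: "real (card (maximal_cliques N E)) \<le> B * d powr \<alpha>"
      using bound[OF finN _ ncl[OF v, folded N_def]] by (simp add: d_def)
    have "(\<Sum>A\<in>\<A>. real (card (maximal_cliques (D A) E)))
        \<le> (\<Sum>A\<in>\<A>. B * d powr (\<alpha> - 1) * real (card (D A)))"
    proof (rule sum_mono)
      fix A assume A: "A \<in> \<A>"
      \<comment> \<open>Any \<open>w\<close> in \<open>A\<close> is joined to all of
        \<open>D A\<close>. So \<open>D A\<close> lies in the neighbourhood of \<open>w\<close>,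
        which makes it \<open>c\<close>-closed and of size at most \<open>d\<close>.\<close>
      then obtain w where w: "w \<in> A" "w \<in> N" "w \<in> W"
        using NW by (auto simp: \<A>_def)
      have Dw: "D A \<subseteq> neighbors W E w"
        using w RW by (auto simp: D_def neighbors_def R_def)
      have Dne: "D A \<noteq> {}" using A by (simp add: \<A>_def)
      have "card (D A) \<le> card (neighbors W E w)"
        by (rule card_mono[OF finite_neighbors[OF fin] Dw])
      hence Dd: "real (card (D A)) \<le> d"
        using max[OF w(3)] by (simp add: d_def N_def)
      have Dpos: "0 < real (card (D A))" using Dne finD by (simp add: card_gt_0_iff)
      have "real (card (maximal_cliques (D A) E)) \<le> B * real (card (D A)) powr \<alpha>"
        by (intro bound finD Dne c_closed_subset[OF ncl[OF w(3)] Dw] finite_neighbors fin)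
      \<comment> \<open>One factor \<open>card (D A)\<close> is kept for the double count; the
        remaining power is bounded through \<open>d\<close>.\<close>
      also have "\<dots> = B * real (card (D A)) powr (\<alpha> - 1) * real (card (D A))"
        using Dpos by (simp add: powr_diff)
      also have "\<dots> \<le> B * d powr (\<alpha> - 1) * real (card (D A))"
        using B Dd \<alpha> by (intro mult_right_mono mult_left_mono powr_mono2) auto
      finally show "real (card (maximal_cliques (D A) E)) \<le> \<dots>" .
    qed
    also have "\<dots> = B * d powr (\<alpha> - 1) * (\<Sum>A\<in>\<A>. real (card (D A)))"
      by (simp add: sum_distrib_left)
    also have "\<dots> \<le> B * d powr (\<alpha> - 1) * (n * 2 ^ c)"
    proof (rule mult_left_mono)
      have "(\<Sum>A\<in>\<A>. card (D A)) \<le> (\<Sum>A\<in>Pow N. card (D A))"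
        using finN by (intro sum_mono2) (auto simp: \<A>_def)
      also have "\<dots> \<le> card R * 2 ^ c"
        unfolding D_def
      proof (rule sum_card_joined_le[OF RW(2) finN])
        fix u assume u: "u \<in> R"
        \<comment> \<open>As \<open>u\<close> lies outside \<open>insert v N\<close>, it is a
          non-neighbour of \<open>v\<close>, so these common neighbours number at most
          \<open>c\<close>.\<close>
        have "{a \<in> N. {a, u} \<in> E} = neighbors W E u \<inter> neighbors W E v"
          using u by (auto simp: R_def N_def neighbors_def insert_commute)
        thus "card {a \<in> N. {a, u} \<in> E} \<le> c"
          using c_closed_card_neighbors_Int[OF cl fin _ v, of u] u
          by (auto simp: R_def N_def)
      qed
      also have "\<dots> \<le> card W * 2 ^ c" using RW fin by (simp add: card_mono)
      finally have "real (\<Sum>A\<in>\<A>. card (D A)) \<le> real (card W * 2 ^ c)" by (rule of_nat_mono)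
      thus "(\<Sum>A\<in>\<A>. real (card (D A))) \<le> n * 2 ^ c" by (simp add: n_def)
    qed (use B in auto)
    finally have bA: "(\<Sum>A\<in>\<A>. real (card (maximal_cliques (D A) E)))
        \<le> B * d powr (\<alpha> - 1) * (n * 2 ^ c)" .
    have "card (maximal_cliques W E) \<le> (if R = {} then 0 else card (maximal_cliques R E))
        + card (maximal_cliques N E) + (\<Sum>A\<in>\<A>. card (maximal_cliques (D A) E))"
      using card_maximal_cliques_delete_neighborhood[OF fin v, of E]
      unfolding N_def R_def D_def \<A>_def .
    hence "real (card (maximal_cliques W E))
        \<le> real (if R = {} then 0 else card (maximal_cliques R E))
        + real (card (maximal_cliques N E)) + (\<Sum>A\<in>\<A>. real (card (maximal_cliques (D A) E)))"
      unfolding of_nat_add[symmetric] of_nat_sum[symmetric] of_nat_le_iff .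
    also have "\<dots> \<le> B * (1 + 2 ^ c) * r powr (1 + \<alpha> / 2) + B * d powr \<alpha>
        + B * d powr (\<alpha> - 1) * (n * 2 ^ c)"
      by (intro add_mono bR bN bA)
    also have "\<dots> = B * ((1 + 2 ^ c) * r powr (1 + \<alpha> / 2) + d powr \<alpha>
        + 2 ^ c * n * d powr (\<alpha> - 1))"
      by (simp add: algebra_simps)
    also have "\<dots> \<le> B * ((1 + 2 ^ c) * n powr (1 + \<alpha> / 2))"
      using B \<alpha> n1 dn r0 rd by (intro mult_left_mono deletion_step_inequality) auto
    finally show ?thesis by (simp add: n_def mult.assoc)
  qed
qed

section \<open>Induction on the closure parameter\<close>

text \<open>Neighbourhoods in a 1-closed graph are 0-closed, hence cliques, and each has one maximal
  clique. This starts the induction at exponent 1.\<close>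

lemma card_maximal_cliques_1_closed:
  assumes fin: "finite W" and ne: "W \<noteq> {}" and cl: "c_closed 1 W E"
  shows "card (maximal_cliques W E) \<le> card W"
proof -
  have "card (maximal_cliques W E) \<le> (\<Sum>w\<in>W. card (maximal_cliques (neighbors W E w) E))"
    by (rule card_maximal_cliques_le_sum_neighbors[OF fin ne])
  also have "\<dots> = (\<Sum>w\<in>W. 1)"
  proof (rule sum.cong[OF refl])
    fix w assume "w \<in> W"
    hence "c_closed 0 (neighbors W E w) E" using cl fin by (intro c_closed_neighbors) auto
    thus "card (maximal_cliques (neighbors W E w) E) = 1"
      by (simp add: maximal_cliques_clique c_closed_0_clique)
  qed
  finally show ?thesis by simp
qed

text \<open>The exponent \<open>2 - 2 powr (- real c)\<close> solves the recursion \<alpha> to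
  \<open>1 + \<alpha> / 2\<close> with initial value 1.\<close>

lemma card_maximal_cliques_subquadratic:
  assumes "finite W" "W \<noteq> {}" "c_closed (Suc c) W E"
  shows "real (card (maximal_cliques W E))
    \<le> 4 powr ((real c + 5) * real c / 2) * real (card W) powr (2 - 2 powr (- real c))"
  using assms
proof (induction c arbitrary: W)
  case 0
  thus ?case using card_maximal_cliques_1_closed[of W E] by simp
next
  case (Suc c)
  let ?B = "4 powr ((real c + 5) * real c / 2)"
  let ?\<alpha> = "2 - 2 powr (- real c)"
  have "2 powr (- real c) \<le> 2 powr 0" by (intro powr_mono) auto
  hence \<alpha>: "1 \<le> ?\<alpha>" "?\<alpha> \<le> 2" by auto
  have "real (card (maximal_cliques W E))
      \<le> ?B * (1 + 2 ^ Suc c) * real (card W) powr (1 + ?\<alpha> / 2)"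
    by (rule card_maximal_cliques_step[OF \<alpha> _ Suc.IH Suc.prems]) (auto intro!: ge_one_powr_ge_zero)
  also have "1 + ?\<alpha> / 2 = 2 - 2 powr (- real (Suc c))"
    by (simp add: powr_diff powr_minus field_simps powr_add)
  also have "?B * (1 + 2 ^ Suc c) * real (card W) powr (2 - 2 powr (- real (Suc c)))
      \<le> 4 powr ((real (Suc c) + 5) * real (Suc c) / 2)
        * real (card W) powr (2 - 2 powr (- real (Suc c)))"
  proof (rule mult_right_mono)
    \<comment> \<open>The exponent of 4 grows by
      \<open>((c + 6) * (c + 1) - (c + 5) * c) / 2 = c + 3\<close>, so the new factor only has to
      stay below \<open>4 ^ (c + 3)\<close>.\<close>
    have "(1 + 2 ^ Suc c :: real) \<le> 4 ^ Suc c"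
    proof -
      have "(2::real) ^ Suc c \<ge> 2" by simp
      hence "1 + 2 ^ Suc c \<le> 2 ^ Suc c * (2 ^ Suc c :: real)"
        using mult_right_mono[of 2 "2 ^ Suc c" "2 ^ Suc c :: real"] by linarith
      thus ?thesis by (simp add: power_mult_distrib[symmetric])
    qed
    also have "\<dots> \<le> 4 ^ (c + 3)" by (rule power_increasing) auto
    also have "\<dots> = (4::real) powr (real c + 3)" by (simp add: powr_realpow[symmetric])
    finally have "?B * (1 + 2 ^ Suc c) \<le> ?B * 4 powr (real c + 3)" by (rule mult_left_mono) simp
    also have "\<dots> = 4 powr ((real (Suc c) + 5) * real (Suc c) / 2)"
      by (subst powr_add[symmetric], rule arg_cong[where f = "(powr) 4"]) (simp add: field_simps)
    finally show "?B * (1 + 2 ^ Suc c) \<le> \<dots>" .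
  qed simp
  finally show ?case .
qed

theorem theorem1p1:
  fixes c n :: nat and V :: "'a set" and E :: "'a set set"
  assumes "c > 0" and "n > 0"
    and "simple_graph V E" and "card V = n" and "c_closed c V E"
  shows "real (card {K. maximal_clique V E K})
    \<le> min (3 powr ((real c - 1) / 3) * real n ^ 2)
          (4 powr ((real c + 4) * (real c - 1) / 2) * real n powr (2 - 2 powr (1 - real c)))"
proof -
  obtain k where c: "c = Suc k" using \<open>c > 0\<close> gr0_implies_Suc by blast
  have V: "finite V" "V \<noteq> {}" "c_closed (Suc k) V E"
    using assms c by (auto simp: simple_graph_def)
  have k: "1 - real c = - real k" "real c + 4 = real k + 5" "real c - 1 = real k"
    by (auto simp: c)
  show ?thesis
    unfolding k min.bounded_iff
    using card_maximal_cliques_quadratic[OF V] card_maximal_cliques_subquadratic[OF V]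
    unfolding maximal_cliques_def assms(4) by blast
qed

end
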